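(* Let $q\in\mathbb{C}$ with $|q|<1$, let $r\ge1$, let $a_1,\dots,a_r,b_1,\dots,b_r$ be positive integers, let $x\in\mathbb{C}$, and let $k$ be a positive odd integer. Then $$E^{(r)}_{k,q}(x\mid a_1,\dots,a_r;b_1,\dots,b_r)=2^r\sum_{n_1,\dots,n_r=0}^{\infty}(-1)^{\sum_{j=1}^r n_j}q^{\sum_{j=1}^r b_jn_j}\Big(\sum_{j=1}^r a_jn_j+x\Big)^k.$$
   Context: For $q\in\mathbb{C}$ with $|q|<1$, the multivariate $q$-Euler polynomials of order $r$, $E^{(r)}_{n,q}(x\mid a_1,\dots,a_r;b_1,\dots,b_r)$, are defined by the generating function (expansion near $t=0$) $$\frac{2^r}{(q^{b_1}e^{a_1t}+1)(q^{b_2}e^{a_2t}+1)\cdots(q^{b_r}e^{a_rt}+1)}\,e^{xt}=\sum_{n=0}^{\infty}E^{(r)}_{n,q}(x\mid a_1,\dots,a_r;b_1,\dots,b_r)\frac{t^n}{n!}.$$ *)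

theory Defs
  imports "HOL-Complex_Analysis.Complex_Analysis"
begin

definition q_Euler_gf ::
    "nat \<Rightarrow> complex \<Rightarrow> complex \<Rightarrow> (nat \<Rightarrow> nat) \<Rightarrow> (nat \<Rightarrow> nat) \<Rightarrow> complex \<Rightarrow> complex" where
  "q_Euler_gf r q x a b t =
     2 ^ r / (\<Prod>j=1..r. q ^ b j * exp (of_nat (a j) * t) + 1) * exp (x * t)"

definition q_Euler_poly ::
    "nat \<Rightarrow> nat \<Rightarrow> complex \<Rightarrow> complex \<Rightarrow> (nat \<Rightarrow> nat) \<Rightarrow> (nat \<Rightarrow> nat) \<Rightarrow> complex" where
  "q_Euler_poly r n q x a b = fact n * fps_nth (fps_expansion (q_Euler_gf r q x a b) 0) n"

text \<open>
  The Taylor coefficients at 0 are the coefficients in the defining generating function identity: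
  for positive exponents \<open>b j\<close> the left-hand side is analytic at 0 and equals the series nearby.
\<close>

lemma q_Euler_gf_analytic:
  assumes "norm q < 1" and "\<And>j. j \<in> {1..r} \<Longrightarrow> b j > 0"
  shows "q_Euler_gf r q x a b analytic_on {0}"
proof -
  have nz: "q ^ b j + 1 \<noteq> 0" if "j \<in> {1..r}" for j
  proof
    assume "q ^ b j + 1 = 0"
    hence "q ^ b j = -1" by (simp add: add_eq_0_iff2)
    hence "norm q ^ b j = 1" by (metis norm_power norm_minus_cancel norm_one)
    moreover have "norm q ^ b j < 1"
      using assms that by (simp add: power_less_one_iff)
    ultimately show False by simp
  qed
  have "(\<lambda>t. 2 ^ r / (\<Prod>j=1..r. q ^ b j * exp (of_nat (a j) * t) + 1) * exp (x * t))
          analytic_on {0}"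
    by (intro analytic_intros) (use nz in auto)
  thus ?thesis
    by (simp add: q_Euler_gf_def [abs_def])
qed

lemma q_Euler_poly_generating_function:
  assumes "norm q < 1" and "\<And>j. j \<in> {1..r} \<Longrightarrow> b j > 0"
  shows "\<forall>\<^sub>F t in nhds 0.
    (\<lambda>n. q_Euler_poly r n q x a b * t ^ n / fact n) sums
    (2 ^ r / (\<Prod>j=1..r. q ^ b j * exp (of_nat (a j) * t) + 1) * exp (x * t))"
proof -
  let ?f = "q_Euler_gf r q x a b"
  let ?F = "fps_expansion ?f 0"
  have "?f has_fps_expansion ?F"
    using q_Euler_gf_analytic [OF assms] by (rule analytic_at_imp_has_fps_expansion_0)
  hence R: "fps_conv_radius ?F > 0" and ev: "\<forall>\<^sub>F t in nhds 0. eval_fps ?F t = ?f t"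
    by (auto simp: has_fps_expansion_def)
  have "\<forall>\<^sub>F t in nhds 0. t \<in> eball 0 (fps_conv_radius ?F)"
    using R by (intro eventually_nhds_in_open) (auto simp: zero_ereal_def)
  with ev show ?thesis
  proof eventually_elim
    case (elim t)
    hence "(\<lambda>n. fps_nth ?F n * t ^ n) sums ?f t"
      using sums_eval_fps [of t ?F] by (simp add: in_eball_iff)
    thus ?case
      by (simp add: q_Euler_poly_def q_Euler_gf_def)
  qed
qed

end

theory Submission
  imports Defs
begin

text \<open>
  For small \<open>t\<close> every factor of the generating function is a geometric series, so the generating
  function is \<open>2^r\<close> times the absolutely convergent sum of \<open>(-1)^|n| q^(b \<cdot> n) exp ((a \<cdot> n + x) t)\<close>
  over all \<open>n\<close>. Expanding the exponentials and exchanging the two summations yields its Taylor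
  coefficients. For the absolute convergence of the double series one bounds \<open>|a \<cdot> n + x|\<close> by
  \<open>a \<cdot> n + |x|\<close>, which leads to the same product of geometric series with \<open>|q|\<close> instead of \<open>-q\<close>.
\<close>

lemma has_sum_geometric:
  fixes z :: "'a :: {real_normed_field, banach}"
  assumes "norm z < 1"
  shows "((\<lambda>n. z ^ n) has_sum (1 / (1 - z))) UNIV"
  using assms
  by (intro norm_summable_imp_has_sum geometric_sums) (auto simp: norm_power intro!: summable_geometric)

text \<open>Absolute convergence in each coordinate lets the sum over tuples factor into one
  geometric series per coordinate. \<open>PiE\<close> fixes the values outside \<open>A\<close>, so
  each tuple is counted exactly once.\<close>

lemma
  fixes z :: "'i \<Rightarrow> 'a :: {real_normed_field, banach, second_countable_topology}"
  assumes "finite A" and z: "\<And>j. j \<in> A \<Longrightarrow> norm (z j) < 1"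
  shows norm_summable_on_geometric_PiE:
      "(\<lambda>n. norm (\<Prod>j\<in>A. z j ^ n j)) summable_on (A \<rightarrow>\<^sub>E (UNIV :: nat set))"
    and infsum_geometric_PiE:
      "(\<Sum>\<^sub>\<infinity>n\<in>A \<rightarrow>\<^sub>E (UNIV :: nat set). \<Prod>j\<in>A. z j ^ n j) = (\<Prod>j\<in>A. 1 / (1 - z j))"
proof -
  have norm_summable: "(\<lambda>n. norm (z j ^ n)) summable_on (UNIV :: nat set)" if "j \<in> A" for j
    using has_sum_geometric[of "norm (z j)"] z[OF that]
    by (auto simp: norm_power summable_on_def)
  show "(\<lambda>n. norm (\<Prod>j\<in>A. z j ^ n j)) summable_on (A \<rightarrow>\<^sub>E (UNIV :: nat set))"
    unfolding abs_summable_equivalent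
    by (intro abs_summable_on_prod_PiE \<open>finite A\<close>)
       (auto simp: abs_summable_equivalent[symmetric] norm_summable)
  have "(\<Sum>\<^sub>\<infinity>n\<in>A \<rightarrow>\<^sub>E (UNIV :: nat set). \<Prod>j\<in>A. z j ^ n j) = (\<Prod>j\<in>A. \<Sum>\<^sub>\<infinity>n. z j ^ n)"
    by (intro infsum_prod_PiE_abs \<open>finite A\<close> norm_summable)
  also have "\<dots> = (\<Prod>j\<in>A. 1 / (1 - z j))"
    by (intro prod.cong refl infsumI has_sum_geometric z)
  finally show "(\<Sum>\<^sub>\<infinity>n\<in>A \<rightarrow>\<^sub>E (UNIV :: nat set). \<Prod>j\<in>A. z j ^ n j) = (\<Prod>j\<in>A. 1 / (1 - z j))" .
qed

lemma has_sum_exp_complex: "((\<lambda>k. z ^ k / fact k) has_sum exp z) UNIV" for z :: complex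
  using norm_summable_imp_has_sum[OF summable_norm_exp exp_converges, of z]
  by (simp add: scaleR_conv_of_real field_simps)

lemma has_sum_exp_real: "((\<lambda>k. z ^ k / fact k) has_sum exp z) UNIV" for z :: real
  using norm_summable_imp_has_sum[OF summable_norm_exp exp_converges, of z]
  by (simp add: field_simps)

text \<open>Fubini for the double family of the terms of all the exponential series. Summing the
  norms over \<open>k\<close> first gives \<open>norm (c i) * exp (norm (s i * t))\<close>, which
  the hypothesis dominates as soon as \<open>norm t \<le> \<rho>\<close>.\<close>

lemma
  fixes c s :: "'i \<Rightarrow> complex"
  assumes "\<rho> > 0" and summable: "(\<lambda>i. norm (c i) * exp (norm (s i) * \<rho>)) summable_on I"
  shows moment_summable_on: "(\<lambda>i. c i * s i ^ k) summable_on I"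
    and moment_series_sums:
      "norm t \<le> \<rho> \<Longrightarrow>
        (\<lambda>k. (\<Sum>\<^sub>\<infinity>i\<in>I. c i * s i ^ k) / fact k * t ^ k) sums (\<Sum>\<^sub>\<infinity>i\<in>I. c i * exp (s i * t))"
proof -
  define F where "F = (\<lambda>t (i, k). c i * ((s i * t) ^ k / fact k))"
  have F: "F t summable_on (I \<times> UNIV)" if t: "norm t \<le> \<rho>" for t
  proof -
    have "((\<lambda>k. norm (F t (i, k))) has_sum norm (c i) * exp (norm (s i * t))) UNIV" for i
      using has_sum_cmult_right[OF has_sum_exp_real, of "norm (c i)" "norm (s i * t)"]
      by (simp add: F_def norm_mult norm_divide norm_power power_mult_distrib)
    moreover have "(\<lambda>i. norm (c i) * exp (norm (s i * t))) summable_on I"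
      by (rule summable_on_comparison_test[OF summable])
         (use t in \<open>auto simp: norm_mult intro!: mult_left_mono\<close>)
    ultimately have "(\<lambda>p. norm (F t p)) summable_on (I \<times> UNIV)"
      by (intro summable_on_SigmaI) auto
    thus ?thesis
      by (rule abs_summable_summable)
  qed
  \<comment> \<open>A slice of a summable double family is summable. Taking
    \<open>t = \<rho>\<close>, which is nonzero, allows the factor
    \<open>\<rho> ^ k / fact k\<close> to be divided out.\<close>
  have moment: "(\<lambda>i. c i * s i ^ k) summable_on I" for k
  proof -
    have "(\<lambda>(k, i). F \<rho> (i, k)) summable_on (UNIV \<times> I)"
      using F[of "of_real \<rho>"] \<open>\<rho> > 0\<close> by (subst summable_on_swap) simp
    hence "(\<lambda>i. F \<rho> (i, k)) summable_on I"
      by (rule summable_on_SigmaD1) auto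
    hence "(\<lambda>i. F \<rho> (i, k) * (fact k / of_real \<rho> ^ k)) summable_on I"
      by (rule summable_on_cmult_left)
    thus ?thesis
      using \<open>\<rho> > 0\<close> by (simp add: F_def power_mult_distrib)
  qed
  show "(\<lambda>i. c i * s i ^ k) summable_on I"
    by (rule moment)
  assume t: "norm t \<le> \<rho>"
  have "((\<lambda>k. F t (i, k)) has_sum c i * exp (s i * t)) UNIV" for i
    using has_sum_cmult_right[OF has_sum_exp_complex, of "c i" "s i * t"] by (simp add: F_def)
  \<comment> \<open>The same double sum is now evaluated in both orders: inner sums over
    \<open>k\<close> rebuild the exponentials, inner sums over \<open>i\<close> give the
    moments.\<close>
  hence exp_sum: "((\<lambda>i. c i * exp (s i * t)) has_sum infsum (F t) (I \<times> UNIV)) I"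
    by (intro has_sum_SigmaD[OF has_sum_infsum[OF F[OF t]]])
  have swapped: "((\<lambda>(k, i). F t (i, k)) has_sum infsum (F t) (I \<times> UNIV)) (UNIV \<times> I)"
    using has_sum_infsum[OF F[OF t]] by (subst has_sum_swap) simp
  have "((\<lambda>i. F t (i, k)) has_sum (\<Sum>\<^sub>\<infinity>i\<in>I. c i * s i ^ k) / fact k * t ^ k) I" for k
    using has_sum_cmult_left[OF has_sum_infsum[OF moment], of k "t ^ k / fact k"]
    by (simp add: F_def power_mult_distrib mult_ac)
  hence
    "((\<lambda>k. (\<Sum>\<^sub>\<infinity>i\<in>I. c i * s i ^ k) / fact k * t ^ k) has_sum infsum (F t) (I \<times> UNIV)) UNIV"
    by (intro has_sum_SigmaD[OF swapped]) simp
  with infsumI[OF exp_sum]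
  show "(\<lambda>k. (\<Sum>\<^sub>\<infinity>i\<in>I. c i * s i ^ k) / fact k * t ^ k) sums (\<Sum>\<^sub>\<infinity>i\<in>I. c i * exp (s i * t))"
    by (auto dest: has_sum_imp_sums)
qed

text \<open>At \<open>\<rho> = 0\<close> each expression is \<open>norm q ^ b j < 1\<close>;
  continuity keeps it below 1 for small \<open>\<rho>\<close>, and finitely many such conditions
  hold together. This makes all the geometric series converge on one disc.\<close>

lemma exists_common_radius:
  fixes q :: complex and a b :: "nat \<Rightarrow> nat"
  assumes "norm q < 1" "finite A" "\<And>j. j \<in> A \<Longrightarrow> b j > 0"
  shows "\<exists>\<rho>>0. \<forall>j\<in>A. norm q ^ b j * exp (real (a j) * \<rho>) < 1"
proof -
  have "\<forall>\<^sub>F \<rho> in at_right 0. norm q ^ b j * exp (real (a j) * \<rho>) < 1" if "j \<in> A" for j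
  proof (rule order_tendstoD)
    show "((\<lambda>\<rho>. norm q ^ b j * exp (real (a j) * \<rho>)) \<longlongrightarrow> norm q ^ b j * exp (real (a j) * 0))
            (at_right 0)"
      by (intro tendsto_intros)
    show "norm q ^ b j * exp (real (a j) * 0) < 1"
      using assms(1) assms(3)[OF that] by (simp add: power_less_one_iff)
  qed
  hence "\<forall>\<^sub>F \<rho> in at_right 0. \<forall>j\<in>A. norm q ^ b j * exp (real (a j) * \<rho>) < 1"
    using \<open>finite A\<close> by (simp add: eventually_ball_finite)
  moreover have "\<forall>\<^sub>F \<rho> in at_right 0. \<rho> > (0 :: real)"
    by (simp add: eventually_at_right_less)
  ultimately have "\<forall>\<^sub>F \<rho> in at_right 0.
      \<rho> > 0 \<and> (\<forall>j\<in>A. norm q ^ b j * exp (real (a j) * \<rho>) < 1)"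
    by eventually_elim auto
  thus ?thesis
    using eventually_happens' trivial_limit_at_right_real by blast
qed

text \<open>Serves both the generating function (\<open>u = -1\<close>, \<open>y = q\<close>,
  complex) and its majorant (\<open>u = 1\<close>, \<open>y = norm q\<close>, real), hence the
  general type and the free sign \<open>u\<close>.\<close>

lemma prod_geometric_eq_exp:
  fixes u y :: "'a :: {real_normed_field, banach}"
  assumes "finite A"
  shows "(\<Prod>j\<in>A. (u * y ^ b j * exp (of_nat (a j) * t)) ^ n j) =
           u ^ (\<Sum>j\<in>A. n j) * y ^ (\<Sum>j\<in>A. b j * n j) * exp (of_nat (\<Sum>j\<in>A. a j * n j) * t)"
proof -
  have "(\<Prod>j\<in>A. (u * y ^ b j * exp (of_nat (a j) * t)) ^ n j) =
          (\<Prod>j\<in>A. u ^ n j * y ^ (b j * n j) * exp (of_nat (a j * n j) * t))"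
    by (intro prod.cong refl)
       (simp add: power_mult_distrib mult_ac flip: power_mult exp_of_nat_mult)
  also have "\<dots> = u ^ (\<Sum>j\<in>A. n j) * y ^ (\<Sum>j\<in>A. b j * n j) *
                    exp (of_nat (\<Sum>j\<in>A. a j * n j) * t)"
    using assms by (simp only: prod.distrib power_sum exp_sum of_nat_sum sum_distrib_right)
  finally show ?thesis .
qed

theorem theorem2:
  fixes q x :: complex and r k :: nat and a b :: "nat \<Rightarrow> nat"
  defines "N \<equiv> {1..r} \<rightarrow>\<^sub>E (UNIV :: nat set)"
  defines "f \<equiv> (\<lambda>n :: nat \<Rightarrow> nat. (-1) ^ (\<Sum>j=1..r. n j) * q ^ (\<Sum>j=1..r. b j * n j) *
                     (of_nat (\<Sum>j=1..r. a j * n j) + x) ^ k)"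
  assumes "norm q < 1" and "r \<ge> 1"
    and "\<And>j. j \<in> {1..r} \<Longrightarrow> a j > 0" and "\<And>j. j \<in> {1..r} \<Longrightarrow> b j > 0"
    and "k > 0" and "odd k"
  shows "f summable_on N \<and>
         q_Euler_poly r k q x a b = 2 ^ r * (\<Sum>\<^sub>\<infinity>n\<in>N. f n)"
proof -
  define c where "c = (\<lambda>n :: nat \<Rightarrow> nat. (-1) ^ (\<Sum>j=1..r. n j) * q ^ (\<Sum>j=1..r. b j * n j))"
  define s where "s = (\<lambda>n :: nat \<Rightarrow> nat. of_nat (\<Sum>j=1..r. a j * n j) + x)"
  have f_eq: "f = (\<lambda>n. c n * s n ^ k)"
    by (simp add: f_def c_def s_def)
  obtain \<rho> where "\<rho> > 0" and \<rho>: "\<And>j. j \<in> {1..r} \<Longrightarrow> norm q ^ b j * exp (real (a j) * \<rho>) < 1"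
    using exists_common_radius[of q "{1..r}" b a] assms by auto
  have summable: "(\<lambda>n. norm (c n) * exp (norm (s n) * \<rho>)) summable_on N"
  proof (rule summable_on_comparison_test)
    let ?g = "\<lambda>n :: nat \<Rightarrow> nat. \<Prod>j=1..r. (1 * norm q ^ b j * exp (of_nat (a j) * \<rho>)) ^ n j"
    have "(\<lambda>n. norm (?g n)) summable_on N"
      unfolding N_def by (rule norm_summable_on_geometric_PiE) (use \<rho> in auto)
    hence "?g summable_on N"
      by (rule abs_summable_summable)
    thus "(\<lambda>n. ?g n * exp (norm x * \<rho>)) summable_on N"
      by (rule summable_on_cmult_left)
    fix n
    have "norm (s n) \<le> real (\<Sum>j=1..r. a j * n j) + norm x"
      unfolding s_def by (metis norm_of_nat norm_triangle_ineq)
    hence "exp (norm (s n) * \<rho>) \<le> exp (real (\<Sum>j=1..r. a j * n j) * \<rho>) * exp (norm x * \<rho>)"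
      using \<open>\<rho> > 0\<close> by (simp flip: exp_add distrib_right)
    hence "norm (c n) * exp (norm (s n) * \<rho>) \<le>
             norm (c n) * (exp (real (\<Sum>j=1..r. a j * n j) * \<rho>) * exp (norm x * \<rho>))"
      by (rule mult_left_mono) simp
    also have "\<dots> = ?g n * exp (norm x * \<rho>)"
      by (subst prod_geometric_eq_exp) (simp_all add: c_def norm_mult norm_power)
    finally show "norm (c n) * exp (norm (s n) * \<rho>) \<le> ?g n * exp (norm x * \<rho>)" .
  qed auto
  have gf: "2 ^ r * (\<Sum>\<^sub>\<infinity>n\<in>N. c n * exp (s n * t)) = q_Euler_gf r q x a b t"
    if t: "norm t \<le> \<rho>" for t
  proof -
    \<comment> \<open>With this sign \<open>1 - z j\<close> is the \<open>j\<close>-th factor of the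
      denominator of the generating function.\<close>
    define z where "z = (\<lambda>j. - 1 * q ^ b j * exp (of_nat (a j) * t))"
    have z: "norm (z j) < 1" if "j \<in> {1..r}" for j
    proof -
      \<comment> \<open>The modulus of \<open>exp (of_nat (a j) * t)\<close> depends only on
        \<open>Re t\<close>.\<close>
      have "Re t \<le> \<rho>"
        using t complex_Re_le_cmod order_trans by blast
      hence "norm q ^ b j * exp (real (a j) * Re t) \<le> norm q ^ b j * exp (real (a j) * \<rho>)"
        by (intro mult_left_mono) (auto intro!: mult_left_mono)
      thus ?thesis
        using \<rho>[OF that] by (simp add: z_def norm_mult norm_power)
    qed
    have "c n * exp (s n * t) = (\<Prod>j=1..r. z j ^ n j) * exp (x * t)" for n
      unfolding z_def
      by (subst prod_geometric_eq_exp) (simp_all add: c_def s_def distrib_right exp_add)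
    hence "(\<Sum>\<^sub>\<infinity>n\<in>N. c n * exp (s n * t)) = (\<Sum>\<^sub>\<infinity>n\<in>N. \<Prod>j=1..r. z j ^ n j) * exp (x * t)"
      by (simp add: infsum_cmult_left')
    also have "(\<Sum>\<^sub>\<infinity>n\<in>N. \<Prod>j=1..r. z j ^ n j) = (\<Prod>j=1..r. 1 / (1 - z j))"
      unfolding N_def by (rule infsum_geometric_PiE) (use z in auto)
    finally show ?thesis
      by (simp add: q_Euler_gf_def z_def prod_dividef add_ac)
  qed
  \<comment> \<open>The bound \<open>k\<close> shadows the fixed one: moments of every order are
    needed to compare whole power series.\<close>
  define M where "M = (\<lambda>k. \<Sum>\<^sub>\<infinity>n\<in>N. c n * s n ^ k)"
  have "\<forall>\<^sub>F t in nhds 0. t \<in> ball (0 :: complex) \<rho>"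
    using \<open>\<rho> > 0\<close> by (intro eventually_nhds_in_open) auto
  hence "\<forall>\<^sub>F t in nhds 0.
      (\<lambda>k. fps_nth (Abs_fps (\<lambda>k. 2 ^ r * M k / fact k)) k * t ^ k) sums q_Euler_gf r q x a b t"
  proof eventually_elim
    case (elim t)
    hence t: "norm t \<le> \<rho>"
      by simp
    show ?case
      using sums_mult[OF moment_series_sums[OF \<open>\<rho> > 0\<close> summable t], of "2 ^ r"]
      unfolding gf[OF t] by (simp add: M_def mult_ac)
  qed
  \<comment> \<open>Uniqueness of power series: a series that sums to the function near 0 is its
    expansion.\<close>
  hence "fps_expansion (q_Euler_gf r q x a b) 0 = Abs_fps (\<lambda>k. 2 ^ r * M k / fact k)"
    by (intro fps_expansion_eqI has_fps_expansionI)
  hence "q_Euler_poly r k q x a b = 2 ^ r * (\<Sum>\<^sub>\<infinity>n\<in>N. f n)"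
    by (simp add: q_Euler_poly_def M_def f_eq)
  \<comment> \<open>Since \<open>infsum\<close> is 0 by convention on a family that is not summable,
    this is what gives the identity its content.\<close>
  moreover have "f summable_on N"
    unfolding f_eq by (rule moment_summable_on[OF \<open>\<rho> > 0\<close> summable])
  ultimately show ?thesis
    by simp
qed

end
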